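(* Let $X=\mathbb{N}\times\mathbb{N}$ be the two-dimensional Chebyshev hypergroup, let $\lambda,\mu\in\mathbb{C}$, and let $M_{\lambda,\mu}:\mathbb{N}\times\mathbb{N}\to\mathbb{C}$ be the exponential $M_{\lambda,\mu}(x,y)=T_x(\lambda)T_y(\mu)$ on $X$. A function $S:\mathbb{N}\times\mathbb{N}\to\mathbb{C}$ is an $M_{\lambda,\mu}$-sine function on $X$ if and only if there are complex numbers $a,b$ such that $$S(x,y)=a\,T_x'(\lambda)\,T_y(\mu)+b\,T_x(\lambda)\,T_y'(\mu)$$ for all $x,y\in\mathbb{N}$.
   Context: $\mathbb{N}=\{0,1,2,\dots\}$. $T_n$ denotes the $n$-th Chebyshev polynomial of the first kind: $T_0(z)=1$, $T_1(z)=z$, and $zT_n(z)=\frac12[T_{n-1}(z)+T_{n+1}(z)]$ for $n\ge1$; $T_n'$ is its derivative. The two-dimensional Chebyshev hypergroup is the discrete commutative hypergroup on $X=\mathbb{N}\times\mathbb{N}$ whose convolution of point masses is $$\delta_{k,l}*\delta_{m,n}=\tfrac14\big[\delta_{|k-m|,|l-n|}+\delta_{|k-m|,l+n}+\delta_{k+m,|l-n|}+\delta_{k+m,l+n}\big]$$ for all $k,l,m,n\in\mathbb{N}$, whose involution is the identity mapping and whose identity element is $(0,0)$. For $h:X\to\mathbb{C}$ and $p,q\in X$ write $h(p*q)=\int_X h\,d(\delta_p*\delta_q)$. An exponential on $X$ is a not identically zero function $M:X\to\mathbb{C}$ with $M(p*q)=M(p)M(q)$ for all $p,q\in X$. The exponentials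 on $X$ are exactly the functions $M_{\lambda,\mu}$. Given an exponential $M$, an $M$-sine function is a function $S:X\to\mathbb{C}$ with $S(p*q)=S(p)M(q)+S(q)M(p)$ for all $p,q\in X$ (the zero function is allowed). *)

theory Defs
  imports
    "HOL-Probability.Probability_Mass_Function"
    "HOL-Computational_Algebra.Polynomial"
begin

fun chebyshev_T :: "nat \<Rightarrow> complex poly" where
  "chebyshev_T 0 = 1"
| "chebyshev_T (Suc 0) = [:0, 1:]"
| "chebyshev_T (Suc (Suc n)) = 2 * [:0, 1:] * chebyshev_T (Suc n) - chebyshev_T n"

text \<open>
  A discrete hypergroup is represented by the convolution of its point masses,
  a probability measure \<open>conv p q\<close> for each pair of points \<open>p\<close>, \<open>q\<close>. The involution and the
  identity element play no role in the notions below.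
\<close>

definition conv_integral :: "('a \<Rightarrow> 'a \<Rightarrow> 'a pmf) \<Rightarrow> ('a \<Rightarrow> complex) \<Rightarrow> 'a \<Rightarrow> 'a \<Rightarrow> complex" where
  "conv_integral conv h p q = (\<integral>z. h z \<partial>measure_pmf (conv p q))"

definition exponential_on :: "('a \<Rightarrow> 'a \<Rightarrow> 'a pmf) \<Rightarrow> ('a \<Rightarrow> complex) \<Rightarrow> bool" where
  "exponential_on conv M \<longleftrightarrow>
     (\<exists>p. M p \<noteq> 0) \<and> (\<forall>p q. conv_integral conv M p q = M p * M q)"

text \<open>Sine functions are only defined relative to an exponential, so that is part of the predicate.\<close>

definition sine_function_on ::
  "('a \<Rightarrow> 'a \<Rightarrow> 'a pmf) \<Rightarrow> ('a \<Rightarrow> complex) \<Rightarrow> ('a \<Rightarrow> complex) \<Rightarrow> bool" where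
  "sine_function_on conv M S \<longleftrightarrow>
     exponential_on conv M \<and> (\<forall>p q. conv_integral conv S p q = S p * M q + S q * M p)"

definition absdiff :: "nat \<Rightarrow> nat \<Rightarrow> nat" where
  "absdiff m n = nat \<bar>int m - int n\<bar>"

text \<open>
  The four points may coincide; as entries of a multiset they are counted with multiplicity,
  each contributing mass \<open>1/4\<close>.
\<close>

definition chebyshev_conv :: "nat \<times> nat \<Rightarrow> nat \<times> nat \<Rightarrow> (nat \<times> nat) pmf" where
  "chebyshev_conv = (\<lambda>(k, l) (m, n). pmf_of_multiset
     {#(absdiff k m, absdiff l n), (absdiff k m, l + n),
       (k + m, absdiff l n), (k + m, l + n)#})"

lemma pmf_chebyshev_conv:
  "pmf (chebyshev_conv (k, l) (m, n)) z =
     1/4 * (indicator {(absdiff k m, absdiff l n)} z + indicator {(absdiff k m, l + n)} z +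
            indicator {(k + m, absdiff l n)} z + indicator {(k + m, l + n)} z)"
  by (auto simp: chebyshev_conv_def indicator_def)

definition chebyshev_exponential :: "complex \<Rightarrow> complex \<Rightarrow> nat \<times> nat \<Rightarrow> complex" where
  "chebyshev_exponential lam mu = (\<lambda>(x, y). poly (chebyshev_T x) lam * poly (chebyshev_T y) mu)"

end

theory Submission
  imports Defs
begin

text \<open>
  A sine function is determined by its values on the two axes, because the point masses at
  \<open>(x, 0)\<close> and \<open>(0, y)\<close> convolve to the single point mass at \<open>(x, y)\<close>. The sine equation at this
  pair reads \<open>S (x, y) = S (x, 0) T\<^sub>y(\<mu>) + S (0, y) T\<^sub>x(\<lambda>)\<close>. On each axis, convolving with the
  generator \<open>1\<close> turns the sine equation into the inhomogeneous recurrence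
  \<open>f (n + 2) = 2 z f (n + 1) + 2 f 1 T\<^bsub>n+1\<^esub>(z) - f n\<close> with \<open>f 0 = 0\<close>. Differentiating the defining
  recurrence of the Chebyshev polynomials shows that \<open>f 1\<close> times the sequence \<open>T\<^sub>n'(z)\<close> solves it,
  so \<open>f n = f 1 T\<^sub>n'(z)\<close>. Hence \<open>a = S (1, 0)\<close> and \<open>b = S (0, 1)\<close>
  (\<open>sine_function_eq_derivative_combination\<close>).

  Conversely, the product formula \<open>T\<^bsub>|k-m|\<^esub> + T\<^bsub>k+m\<^esub> = 2 T\<^sub>k T\<^sub>m\<close> says that \<open>T\<^sub>x(\<lambda>) T\<^sub>y(\<mu>)\<close> is an
  exponential. Its partial derivatives with respect to \<open>\<lambda>\<close> and \<open>\<mu>\<close> are sine functions by the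
  Leibniz rule, and the sine equation is linear in \<open>S\<close>.
\<close>

lemma absdiff_commute: "absdiff m n = absdiff n m"
  by (simp add: absdiff_def abs_minus_commute)

lemma absdiff_add_left [simp]: "absdiff (m + d) m = d"
  by (simp add: absdiff_def)

lemma absdiff_0 [simp]: "absdiff n 0 = n" "absdiff 0 n = n"
  by (simp_all add: absdiff_def)

lemma absdiff_Suc_1 [simp]: "absdiff (Suc n) (Suc 0) = n"
  by (simp add: absdiff_def)

text \<open>
  The support may have fewer than four points, so the mass at a point is kept as a sum of four
  indicators. Each indicator picks out one value of \<open>h\<close>, which then enters with its multiplicity.
\<close>

lemma conv_integral_chebyshev:
  "conv_integral chebyshev_conv h (k, l) (m, n) =
     (h (absdiff k m, absdiff l n) + h (absdiff k m, l + n) +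
      h (k + m, absdiff l n) + h (k + m, l + n)) / 4"
proof -
  let ?A = "{(absdiff k m, absdiff l n), (absdiff k m, l + n),
             (k + m, absdiff l n), (k + m, l + n)}"
  have point: "(\<Sum>z\<in>?A. (indicator {p} z :: real) *\<^sub>R h z) = h p" if "p \<in> ?A" for p
  proof -
    have "(\<Sum>z\<in>?A. (indicator {p} z :: real) *\<^sub>R h z) = (\<Sum>z\<in>?A. if z = p then h z else 0)"
      by (rule sum.cong) (auto simp: indicator_def)
    also have "\<dots> = h p"
      using that by (simp only: sum.delta finite_insert finite.emptyI if_True)
    finally show ?thesis .
  qed
  have "conv_integral chebyshev_conv h (k, l) (m, n) =
      (\<Sum>z\<in>?A. pmf (chebyshev_conv (k, l) (m, n)) z *\<^sub>R h z)"
    unfolding conv_integral_def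
    by (rule integral_measure_pmf) (auto simp: chebyshev_conv_def)
  also have "\<dots> = (1/4) *\<^sub>R
      ((\<Sum>z\<in>?A. (indicator {(absdiff k m, absdiff l n)} z :: real) *\<^sub>R h z) +
       (\<Sum>z\<in>?A. (indicator {(absdiff k m, l + n)} z :: real) *\<^sub>R h z) +
       (\<Sum>z\<in>?A. (indicator {(k + m, absdiff l n)} z :: real) *\<^sub>R h z) +
       (\<Sum>z\<in>?A. (indicator {(k + m, l + n)} z :: real) *\<^sub>R h z))"
    by (simp only: pmf_chebyshev_conv scaleR_sum_right sum.distrib scaleR_add_left scaleR_add_right
        scaleR_scaleR distrib_left)
  also have "\<dots> = (1/4) *\<^sub>R (h (absdiff k m, absdiff l n) + h (absdiff k m, l + n) +
      h (k + m, absdiff l n) + h (k + m, l + n))"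
    by (simp only: point insert_iff simp_thms)
  finally show ?thesis
    by (simp add: scaleR_conv_of_real)
qed

text \<open>
  With the difference \<open>d\<close> of the two indices as a free parameter, no absolute value appears and
  induction on the smaller index \<open>m\<close> works: expanding \<open>T\<^bsub>m+2\<^esub>\<close> leaves the products of \<open>T\<^bsub>m+2+d\<^esub>\<close> with
  \<open>T\<^bsub>m+1\<^esub>\<close> and \<open>T\<^sub>m\<close>, to which the hypotheses for the differences \<open>d + 1\<close> and \<open>d + 2\<close> apply.
\<close>

lemma chebyshev_T_product_ordered:
  "chebyshev_T d + chebyshev_T (d + 2 * m) = 2 * chebyshev_T (m + d) * chebyshev_T m"
proof (induction m arbitrary: d rule: chebyshev_T.induct)
  case 1
  show ?case
    by simp
next
  case 2
  have indices: "d + 2 * Suc 0 = Suc (Suc d)" "Suc 0 + d = Suc d"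
    by simp_all
  show ?case
    unfolding indices chebyshev_T.simps by algebra
next
  case (3 m)
  let ?z = "[:0, 1:] :: complex poly"
  have IH1: "chebyshev_T (d + 1) + chebyshev_T (d + 2 * m + 3) =
      2 * chebyshev_T (m + d + 2) * chebyshev_T (Suc m)"
    using "3.IH"(1)[of "d + 1"] by (simp add: eval_nat_numeral)
  have IH2: "chebyshev_T (d + 2) + chebyshev_T (d + 2 * m + 2) =
      2 * chebyshev_T (m + d + 2) * chebyshev_T m"
    using "3.IH"(2)[of "d + 2"] by (simp add: eval_nat_numeral)
  have low: "chebyshev_T (d + 2) = 2 * ?z * chebyshev_T (d + 1) - chebyshev_T d"
    by (simp add: eval_nat_numeral)
  have high: "chebyshev_T (d + 2 * m + 4) =
      2 * ?z * chebyshev_T (d + 2 * m + 3) - chebyshev_T (d + 2 * m + 2)"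
    by (simp add: eval_nat_numeral)
  have "2 * chebyshev_T (m + d + 2) * chebyshev_T (Suc (Suc m)) =
      2 * ?z * (2 * chebyshev_T (m + d + 2) * chebyshev_T (Suc m)) -
      2 * chebyshev_T (m + d + 2) * chebyshev_T m"
    unfolding chebyshev_T.simps by algebra
  also have "\<dots> = 2 * ?z * (chebyshev_T (d + 1) + chebyshev_T (d + 2 * m + 3)) -
      (chebyshev_T (d + 2) + chebyshev_T (d + 2 * m + 2))"
    unfolding IH1 IH2 ..
  also have "\<dots> = chebyshev_T d + chebyshev_T (d + 2 * m + 4)"
    unfolding low high by algebra
  finally have "2 * chebyshev_T (m + d + 2) * chebyshev_T (Suc (Suc m)) =
      chebyshev_T d + chebyshev_T (d + 2 * m + 4)" .
  moreover have "Suc (Suc m) + d = m + d + 2" "d + 2 * Suc (Suc m) = d + 2 * m + 4"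
    by simp_all
  ultimately show ?case
    by (simp only:)
qed

text \<open>
  This is the identity \<open>2 cos (k t) cos (m t) = cos ((k - m) t) + cos ((k + m) t)\<close> in algebraic
  form. Both sides are symmetric in \<open>k\<close> and \<open>m\<close>, so the ordered case suffices.
\<close>

lemma chebyshev_T_product:
  "chebyshev_T (absdiff k m) + chebyshev_T (k + m) = 2 * chebyshev_T k * chebyshev_T m"
proof (induction k m rule: linorder_wlog)
  case (le k m)
  then obtain d where "m = k + d"
    using le_Suc_ex by blast
  then have "absdiff k m = d" "k + m = d + 2 * k" "m = k + d"
    by (simp_all add: absdiff_commute[of k])
  then show ?case
    using chebyshev_T_product_ordered[of d k] by (simp only: ac_simps)
next
  case (sym k m)
  then show ?case
    by (simp add: absdiff_commute ac_simps)
qed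

lemma poly_chebyshev_T_product:
  "poly (chebyshev_T (absdiff k m)) z + poly (chebyshev_T (k + m)) z =
     2 * poly (chebyshev_T k) z * poly (chebyshev_T m) z"
  using arg_cong[OF chebyshev_T_product[of k m], of "\<lambda>p. poly p z"] by simp

lemma poly_pderiv_chebyshev_T_product:
  "poly (pderiv (chebyshev_T (absdiff k m))) z + poly (pderiv (chebyshev_T (k + m))) z =
     2 * (poly (pderiv (chebyshev_T k)) z * poly (chebyshev_T m) z +
          poly (chebyshev_T k) z * poly (pderiv (chebyshev_T m)) z)"
proof -
  have "pderiv (chebyshev_T (absdiff k m) + chebyshev_T (k + m)) =
      pderiv (smult 2 (chebyshev_T k * chebyshev_T m))"
    using chebyshev_T_product[of k m] by (simp add: numeral_poly)
  then have "poly (pderiv (chebyshev_T (absdiff k m) + chebyshev_T (k + m))) z =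
      poly (pderiv (smult 2 (chebyshev_T k * chebyshev_T m))) z"
    by (rule arg_cong)
  then show ?thesis
    by (simp add: pderiv_add pderiv_smult pderiv_mult algebra_simps)
qed

lemma exponential_on_chebyshev_exponential:
  "exponential_on chebyshev_conv (chebyshev_exponential lam mu)"
proof -
  let ?M = "chebyshev_exponential lam mu"
  have "conv_integral chebyshev_conv ?M (k, l) (m, n) = ?M (k, l) * ?M (m, n)" for k l m n
  proof -
    have "conv_integral chebyshev_conv ?M (k, l) (m, n) =
        (poly (chebyshev_T (absdiff k m)) lam + poly (chebyshev_T (k + m)) lam) *
        (poly (chebyshev_T (absdiff l n)) mu + poly (chebyshev_T (l + n)) mu) / 4"
      by (simp add: conv_integral_chebyshev chebyshev_exponential_def algebra_simps)
    then show ?thesis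
      by (simp add: poly_chebyshev_T_product chebyshev_exponential_def)
  qed
  moreover have "?M (0, 0) \<noteq> 0"
    by (simp add: chebyshev_exponential_def)
  ultimately show ?thesis
    unfolding exponential_on_def by (metis surj_pair)
qed

lemma sine_function_derivative_combination:
  assumes S: "\<And>x y. S (x, y) = a * poly (pderiv (chebyshev_T x)) lam * poly (chebyshev_T y) mu
      + b * poly (chebyshev_T x) lam * poly (pderiv (chebyshev_T y)) mu"
  shows "sine_function_on chebyshev_conv (chebyshev_exponential lam mu) S"
proof -
  let ?M = "chebyshev_exponential lam mu"
  have "conv_integral chebyshev_conv S (k, l) (m, n) = S (k, l) * ?M (m, n) + S (m, n) * ?M (k, l)"
    for k l m n
  proof -
    \<comment> \<open>In each summand of \<open>S\<close> the variables separate, so the mean over the four points is a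
      product of two means to which the one-dimensional formulas apply.\<close>
    have "conv_integral chebyshev_conv S (k, l) (m, n) =
       (a * (poly (pderiv (chebyshev_T (absdiff k m))) lam + poly (pderiv (chebyshev_T (k + m))) lam)
          * (poly (chebyshev_T (absdiff l n)) mu + poly (chebyshev_T (l + n)) mu) +
        b * (poly (chebyshev_T (absdiff k m)) lam + poly (chebyshev_T (k + m)) lam)
          * (poly (pderiv (chebyshev_T (absdiff l n))) mu + poly (pderiv (chebyshev_T (l + n))) mu)) / 4"
      by (simp add: conv_integral_chebyshev S algebra_simps)
    then show ?thesis
      unfolding poly_chebyshev_T_product poly_pderiv_chebyshev_T_product
      by (simp add: S chebyshev_exponential_def algebra_simps add_divide_distrib)
  qed
  then show ?thesis
    unfolding sine_function_on_def
    by (metis surj_pair exponential_on_chebyshev_exponential)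
qed

text \<open>
  The recurrence is second order, so \<open>f 0 = 0\<close> and \<open>f 1\<close> determine \<open>f\<close>. The sequence on the right
  satisfies it with the same initial values, as \<open>T\<^sub>0' = 0\<close> and \<open>T\<^sub>1' = 1\<close>; the inhomogeneous term
  comes from differentiating the factor \<open>z\<close> in \<open>2 z T\<^bsub>n+1\<^esub>\<close>.
\<close>

lemma inhomogeneous_chebyshev_recurrence_solution:
  assumes "f 0 = 0"
    and "\<And>n. f (Suc (Suc n)) = 2 * z * f (Suc n) + 2 * f 1 * poly (chebyshev_T (Suc n)) z - f n"
  shows "f n = f 1 * poly (pderiv (chebyshev_T n)) z"
proof (induction n rule: chebyshev_T.induct)
  case (3 n)
  have "pderiv (chebyshev_T (Suc (Suc n))) =
      pderiv (smult 2 ([:0, 1:] * chebyshev_T (Suc n)) - chebyshev_T n)"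
    by (simp add: numeral_poly)
  then have "poly (pderiv (chebyshev_T (Suc (Suc n)))) z =
      poly (pderiv (smult 2 ([:0, 1:] * chebyshev_T (Suc n)) - chebyshev_T n)) z"
    by (rule arg_cong)
  then have step: "poly (pderiv (chebyshev_T (Suc (Suc n)))) z =
      2 * poly (chebyshev_T (Suc n)) z + 2 * z * poly (pderiv (chebyshev_T (Suc n))) z
      - poly (pderiv (chebyshev_T n)) z"
    by (simp add: pderiv_diff pderiv_smult pderiv_mult pderiv_pCons algebra_simps
        del: chebyshev_T.simps)
  show ?case
    unfolding assms(2)[of n] "3.IH" step by (simp add: algebra_simps del: chebyshev_T.simps)
qed (use assms(1) in \<open>simp_all add: pderiv_pCons\<close>)

lemma sine_function_eq_derivative_combination:
  assumes "sine_function_on chebyshev_conv (chebyshev_exponential lam mu) S"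
  shows "S (x, y) = S (1, 0) * poly (pderiv (chebyshev_T x)) lam * poly (chebyshev_T y) mu
      + S (0, 1) * poly (chebyshev_T x) lam * poly (pderiv (chebyshev_T y)) mu"
proof -
  let ?M = "chebyshev_exponential lam mu"
  have sine: "(S (absdiff k m, absdiff l n) + S (absdiff k m, l + n) +
       S (k + m, absdiff l n) + S (k + m, l + n)) / 4 = S (k, l) * ?M (m, n) + S (m, n) * ?M (k, l)"
    for k l m n
    using assms unfolding sine_function_on_def conv_integral_chebyshev[symmetric] by blast
  have zero: "S (0, 0) = 0"
    using sine[of 0 0 0 0] by (simp add: chebyshev_exponential_def)
  \<comment> \<open>When both second coordinates are \<open>0\<close>, the four points of the convolution coincide in pairs,
    so the sine equation on an axis is one-dimensional.\<close>
  have "S (n, 0) + S (Suc (Suc n), 0) =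
      2 * (S (Suc n, 0) * lam + S (1, 0) * poly (chebyshev_T (Suc n)) lam)" for n
  proof -
    have "S (n, 0) + S (Suc (Suc n), 0) =
        2 * ((S (n, 0) + S (n, 0) + S (Suc (Suc n), 0) + S (Suc (Suc n), 0)) / 4)"
      by simp
    also have "(S (n, 0) + S (n, 0) + S (Suc (Suc n), 0) + S (Suc (Suc n), 0)) / 4 =
        S (Suc n, 0) * lam + S (1, 0) * poly (chebyshev_T (Suc n)) lam"
      using sine[of "Suc n" 1 0 0] by (simp add: chebyshev_exponential_def del: chebyshev_T.simps(3))
    finally show ?thesis .
  qed
  then have "S (Suc (Suc n), 0) =
      2 * lam * S (Suc n, 0) + 2 * S (1, 0) * poly (chebyshev_T (Suc n)) lam - S (n, 0)" for n
    by (simp add: algebra_simps del: chebyshev_T.simps(3))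
  then have x_axis: "S (x, 0) = S (1, 0) * poly (pderiv (chebyshev_T x)) lam"
    by (intro inhomogeneous_chebyshev_recurrence_solution[where f = "\<lambda>n. S (n, 0)"] zero)
  have "S (0, n) + S (0, Suc (Suc n)) =
      2 * (S (0, Suc n) * mu + S (0, 1) * poly (chebyshev_T (Suc n)) mu)" for n
  proof -
    have "S (0, n) + S (0, Suc (Suc n)) =
        2 * ((S (0, n) + S (0, Suc (Suc n)) + S (0, n) + S (0, Suc (Suc n))) / 4)"
      by simp
    also have "(S (0, n) + S (0, Suc (Suc n)) + S (0, n) + S (0, Suc (Suc n))) / 4 =
        S (0, Suc n) * mu + S (0, 1) * poly (chebyshev_T (Suc n)) mu"
      using sine[of 0 0 "Suc n" 1] by (simp add: chebyshev_exponential_def del: chebyshev_T.simps(3))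
    finally show ?thesis .
  qed
  then have "S (0, Suc (Suc n)) =
      2 * mu * S (0, Suc n) + 2 * S (0, 1) * poly (chebyshev_T (Suc n)) mu - S (0, n)" for n
    by (simp add: algebra_simps del: chebyshev_T.simps(3))
  then have y_axis: "S (0, y) = S (0, 1) * poly (pderiv (chebyshev_T y)) mu"
    by (intro inhomogeneous_chebyshev_recurrence_solution[where f = "\<lambda>n. S (0, n)"] zero)
  \<comment> \<open>For the pair \<open>(x, 0)\<close>, \<open>(0, y)\<close> all four points coincide with \<open>(x, y)\<close>.\<close>
  have "S (x, y) = S (x, 0) * poly (chebyshev_T y) mu + S (0, y) * poly (chebyshev_T x) lam"
    using sine[of x 0 0 y] by (simp add: chebyshev_exponential_def)
  then show ?thesis
    by (simp add: x_axis y_axis)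
qed

theorem theorem2p2:
  fixes lam mu :: complex and S :: "nat \<times> nat \<Rightarrow> complex"
  shows "sine_function_on chebyshev_conv (chebyshev_exponential lam mu) S \<longleftrightarrow>
    (\<exists>a b :: complex. \<forall>x y :: nat.
       S (x, y) = a * poly (pderiv (chebyshev_T x)) lam * poly (chebyshev_T y) mu
                + b * poly (chebyshev_T x) lam * poly (pderiv (chebyshev_T y)) mu)"
  using sine_function_eq_derivative_combination sine_function_derivative_combination by blast

end
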